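(* Let $\delta=1$ (resp. $\delta=-1$), let $k_0,k_1,k_2\in\mathbb{R}\setminus\{0\}$, $k_3\in\mathbb{R}$, and let $q(u_x,v_x)$ be an arbitrary smooth function of $(u_x,v_x)$ such that $k_2q_{v_x}-k_1q_{u_x}\neq0$. Then the system $$u_{xt}=\frac{k_0}{k_2q_{v_x}-k_1q_{u_x}}\Big[q_{v_x}+(k_1v+k_2u+k_3)\big(\delta k_1(k_1v_x+k_2u_x)-q\,q_{v_x}\big)\Big],$$ $$v_{xt}=\frac{-k_0}{k_2q_{v_x}-k_1q_{u_x}}\Big[q_{u_x}+(k_1v+k_2u+k_3)\big(\delta k_2(k_1v_x+k_2u_x)-q\,q_{u_x}\big)\Big]$$ describes pseudospherical surfaces (resp. spherical surfaces), with associated functions $$f_{11}=\eta(k_1v_x+k_2u_x),\quad f_{12}=0,\quad f_{21}=\eta^2,\quad f_{22}=k_0(k_1v+k_2u)+k_0k_3,\quad f_{31}=\eta\,q(u_x,v_x),\quad f_{32}=\tfrac1\eta k_0,$$ where $\eta\neq0$ is a real parameter.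
   Context: $q_{u_x},q_{v_x}$ denote the partial derivatives of $q$ with respect to its first and second arguments. Definition. A system of PDEs for $u(x,t),v(x,t)$ describes pseudospherical surfaces (take $\delta=1$), resp. spherical surfaces (take $\delta=-1$), with associated functions $f_{ij}$, $1\le i\le 3$, $1\le j\le 2$, if the system is equivalent to (i.e. has exactly the same solutions $(u,v)$ as) the structure equations $d\omega_1=\omega_3\wedge\omega_2$, $d\omega_2=\omega_1\wedge\omega_3$, $d\omega_3=\delta\,\omega_1\wedge\omega_2$ of a surface with Gaussian curvature $K=-\delta$, where $\omega_i=f_{i1}dx+f_{i2}dt$ and $f_{ij}$ are evaluated on $u,v$ and their derivatives, with $\omega_1\wedge\omega_2\neq0$, i.e. $f_{11}f_{22}-f_{12}f_{21}\ne 0$, for generic solutions (on a suitable nonempty open set); i.e. $f_{11}f_{22}-f_{12}f_{21}$, as a function of $(u,u_x,v,v_x)$, is nonzero up to a set of measure zero. *)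

theory Defs
  imports "HOL-Analysis.Analysis"
begin

definition partial1 :: "(real \<times> real \<Rightarrow> real) \<Rightarrow> real \<times> real \<Rightarrow> real" where
  "partial1 h = (\<lambda>(a, b). deriv (\<lambda>s. h (s, b)) a)"

definition partial2 :: "(real \<times> real \<Rightarrow> real) \<Rightarrow> real \<times> real \<Rightarrow> real" where
  "partial2 h = (\<lambda>(a, b). deriv (\<lambda>s. h (a, s)) b)"

text \<open>Meant for open \<open>S\<close>: all derivatives are taken in the ambient space.\<close>

primrec Ck_on :: "nat \<Rightarrow> 'a::euclidean_space set \<Rightarrow> ('a \<Rightarrow> real) \<Rightarrow> bool" where
  "Ck_on 0 S h \<longleftrightarrow> continuous_on S h"
| "Ck_on (Suc n) S h \<longleftrightarrow>
     (\<forall>x\<in>S. h differentiable (at x)) \<and>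
     (\<forall>d. Ck_on n S (\<lambda>x. frechet_derivative h (at x) d))"

definition smooth_on :: "'a::euclidean_space set \<Rightarrow> ('a \<Rightarrow> real) \<Rightarrow> bool" where
  "smooth_on S h \<longleftrightarrow> (\<forall>n. Ck_on n S h)"

text \<open>A differential 1-form (2-form) on the \<open>(x, t)\<close>-plane assigns to each point a linear
  (alternating bilinear) function of tangent vectors; linearity is not built into the types.\<close>

type_synonym form1 = "real \<times> real \<Rightarrow> real \<times> real \<Rightarrow> real"
type_synonym form2 = "real \<times> real \<Rightarrow> real \<times> real \<Rightarrow> real \<times> real \<Rightarrow> real"

definition wedge :: "form1 \<Rightarrow> form1 \<Rightarrow> form2" where
  "wedge \<alpha> \<beta> = (\<lambda>p a b. \<alpha> p a * \<beta> p b - \<alpha> p b * \<beta> p a)"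

definition ext_d :: "form1 \<Rightarrow> form2" where
  "ext_d \<alpha> = (\<lambda>p a b. frechet_derivative (\<lambda>r. \<alpha> r b) (at p) a
                      - frechet_derivative (\<lambda>r. \<alpha> r a) (at p) b)"

text \<open>The tuple \<open>(u, u\<^sub>x, v, v\<^sub>x)\<close>, the arguments of the associated functions.\<close>

type_synonym jet = "real \<times> real \<times> real \<times> real"

definition jet_of :: "(real \<times> real \<Rightarrow> real) \<Rightarrow> (real \<times> real \<Rightarrow> real) \<Rightarrow> real \<times> real \<Rightarrow> jet" where
  "jet_of u v p = (u p, partial1 u p, v p, partial1 v p)"

definition assoc_form ::
  "(nat \<Rightarrow> nat \<Rightarrow> jet \<Rightarrow> real) \<Rightarrow> (real \<times> real \<Rightarrow> real) \<Rightarrow> (real \<times> real \<Rightarrow> real) \<Rightarrow> nat \<Rightarrow> form1" where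
  "assoc_form f u v i =
     (\<lambda>p (dx, dt). f i 1 (jet_of u v p) * dx + f i 2 (jet_of u v p) * dt)"

definition structure_equations ::
  "real \<Rightarrow> form1 \<Rightarrow> form1 \<Rightarrow> form1 \<Rightarrow> real \<times> real \<Rightarrow> bool" where
  "structure_equations \<delta> \<omega>1 \<omega>2 \<omega>3 p \<longleftrightarrow>
     ext_d \<omega>1 p = wedge \<omega>3 \<omega>2 p \<and>
     ext_d \<omega>2 p = wedge \<omega>1 \<omega>3 p \<and>
     ext_d \<omega>3 p = (\<lambda>a b. \<delta> * wedge \<omega>1 \<omega>2 p a b)"

text \<open>A PDE system is given as the predicate \<open>sys u v p\<close>: the equations hold for \<open>(u, v)\<close> at the
  point \<open>p = (x, t)\<close>. The set \<open>D\<close> is the domain of definition of the system and of the \<open>f i j\<close>;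
  solutions are smooth functions on arbitrary open sets \<open>\<Omega>\<close> of the plane whose jets stay in \<open>D\<close>.
  The surfaces are pseudospherical (\<open>K = -1\<close>) for \<open>\<delta> = 1\<close> and spherical (\<open>K = 1\<close>)
  for \<open>\<delta> = -1\<close>.\<close>

definition describes_surfaces ::
  "real \<Rightarrow> jet set
   \<Rightarrow> ((real \<times> real \<Rightarrow> real) \<Rightarrow> (real \<times> real \<Rightarrow> real) \<Rightarrow> real \<times> real \<Rightarrow> bool)
   \<Rightarrow> (nat \<Rightarrow> nat \<Rightarrow> jet \<Rightarrow> real) \<Rightarrow> bool" where
  "describes_surfaces \<delta> D sys f \<longleftrightarrow>
     open D \<and> D \<noteq> {} \<and>
     (\<forall>i\<in>{1..3}. \<forall>j\<in>{1..2}. smooth_on D (f i j)) \<and>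
     (\<forall>\<Omega> u v. open \<Omega> \<and> smooth_on \<Omega> u \<and> smooth_on \<Omega> v \<and> (\<forall>p\<in>\<Omega>. jet_of u v p \<in> D) \<longrightarrow>
        ((\<forall>p\<in>\<Omega>. sys u v p) \<longleftrightarrow>
         (\<forall>p\<in>\<Omega>. structure_equations \<delta>
            (assoc_form f u v 1) (assoc_form f u v 2) (assoc_form f u v 3) p))) \<and>
     negligible {z \<in> D. f 1 1 z * f 2 2 z - f 1 2 z * f 2 1 z = 0}"

definition describes_pseudospherical_surfaces where
  "describes_pseudospherical_surfaces = describes_surfaces 1"

definition describes_spherical_surfaces where
  "describes_spherical_surfaces = describes_surfaces (-1)"

end

theory Submission
  imports Defs
begin

text \<open>
  Put \<open>w = k1 * v + k2 * u\<close>, \<open>L = w + k3\<close> and \<open>Q = q (u\<^sub>x, v\<^sub>x)\<close>. In the plane a 2-form has a single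
  coefficient, so the three structure equations are three scalar equations
  (\<open>structure_equations_iff\<close>). For the given associated functions, the second one reads
  \<open>k0 * w\<^sub>x = k0 * w\<^sub>x\<close>, and the other two become
  \<open>k2 * u\<^sub>x\<^sub>t + k1 * v\<^sub>x\<^sub>t = k0 * (1 - Q * L)\<close> and, since the left-hand side below is \<open>Q\<^sub>t\<close> by the
  chain rule, \<open>q\<^sub>1 * u\<^sub>x\<^sub>t + q\<^sub>2 * v\<^sub>x\<^sub>t = - \<delta> * k0 * w\<^sub>x * L\<close>, where \<open>q\<^sub>1, q\<^sub>2\<close> are the partial
  derivatives of \<open>q\<close>. This is a linear system for \<open>(u\<^sub>x\<^sub>t, v\<^sub>x\<^sub>t)\<close> with determinant
  \<open>k2 * q\<^sub>2 - k1 * q\<^sub>1 \<noteq> 0\<close>; Cramer's rule (\<open>cramer_for_mixed_derivatives\<close>) turns it into the PDE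
  system, pointwise and in both directions.

  The area coefficient \<open>f\<^sub>1\<^sub>1 * f\<^sub>2\<^sub>2\<close> is a nonzero constant times \<open>w\<^sub>x * L\<close>, a product of two nonconstant
  affine functions of the jet, so it vanishes only on two hyperplanes.
\<close>

section \<open>Smooth functions\<close>

lemma Ck_on_cong:
  assumes "open S" and "\<And>x. x \<in> S \<Longrightarrow> g x = h x" and "Ck_on n S g"
  shows "Ck_on n S h"
  using assms(2,3)
proof (induction n arbitrary: g h)
  case 0
  then show ?case
    using continuous_on_cong[of S S g h] by simp
next
  case (Suc n)
  have der: "(h has_derivative frechet_derivative g (at x)) (at x)" if "x \<in> S" for x
  proof (rule has_derivative_transform_within_open[OF _ assms(1) that])
    show "(g has_derivative frechet_derivative g (at x)) (at x)"
      using Suc.prems(2) that by (simp add: frechet_derivative_works[symmetric])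
  qed (fact Suc.prems(1))
  have "Ck_on n S (\<lambda>x. frechet_derivative h (at x) d)" for d
  proof (rule Suc.IH[where g = "\<lambda>x. frechet_derivative g (at x) d"])
    show "frechet_derivative g (at x) d = frechet_derivative h (at x) d" if "x \<in> S" for x
      using frechet_derivative_at[OF der[OF that]] by simp
    show "Ck_on n S (\<lambda>x. frechet_derivative g (at x) d)"
      using Suc.prems by simp
  qed
  then show ?case
    using der by (auto simp: differentiable_def)
qed

lemma Ck_on_const: "Ck_on n S (\<lambda>_. c)"
  by (induction n arbitrary: c) auto

lemma smooth_on_affine:
  assumes "bounded_linear l"
  shows "smooth_on S (\<lambda>x. l x + c)"
proof -
  have der: "((\<lambda>x. l x + c) has_derivative l) (at x)" for x
    using has_derivative_add[OF bounded_linear_imp_has_derivative[OF assms] has_derivative_const]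
    by simp
  have "frechet_derivative (\<lambda>x. l x + c) (at x) = l" for x
    by (rule frechet_derivative_at[OF der, symmetric])
  moreover have "continuous_on S (\<lambda>x. l x + c)"
    using assms by (intro continuous_intros linear_continuous_on)
  ultimately have "Ck_on n S (\<lambda>x. l x + c)" for n
    using der by (cases n) (auto simp: Ck_on_const differentiable_def)
  then show ?thesis
    by (simp add: smooth_on_def)
qed

lemma smooth_on_const: "smooth_on S (\<lambda>_. c)"
  by (simp add: smooth_on_def Ck_on_const)

text \<open>
  A linear inner map keeps the induction on the order of differentiability inside this class of
  functions: the derivative of \<open>\<lambda>x. c * h (l x)\<close> in the direction \<open>d\<close> is \<open>c\<close> times the derivative of
  \<open>h\<close> in the fixed direction \<open>l d\<close>, again composed with \<open>l\<close>.
\<close>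

lemma Ck_on_scaled_compose_linear:
  assumes "open S" and "bounded_linear l" and "Ck_on n S h"
  shows "Ck_on n (l -` S) (\<lambda>x. c * h (l x))"
  using assms(3)
proof (induction n arbitrary: h)
  case 0
  then show ?case
    using linear_continuous_on[OF assms(2)]
    by (auto intro!: continuous_on_mult_left continuous_on_compose2[of S h])
next
  case (Suc n)
  have der: "((\<lambda>x. c * h (l x)) has_derivative (\<lambda>d. c * frechet_derivative h (at (l x)) (l d))) (at x)"
    if "l x \<in> S" for x
  proof -
    have "(h has_derivative frechet_derivative h (at (l x))) (at (l x))"
      using Suc.prems that by (simp add: frechet_derivative_works[symmetric])
    then have "((\<lambda>x. h (l x)) has_derivative (\<lambda>d. frechet_derivative h (at (l x)) (l d))) (at x)"
      using has_derivative_compose[OF bounded_linear_imp_has_derivative[OF assms(2)]] by blast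
    then show ?thesis
      by (rule has_derivative_mult_right)
  qed
  have "open (l -` S)"
    using assms(1,2) by (simp add: open_vimage linear_continuous_on)
  then have "Ck_on n (l -` S) (\<lambda>x. frechet_derivative (\<lambda>x. c * h (l x)) (at x) d)" for d
  proof (rule Ck_on_cong)
    show "c * frechet_derivative h (at (l x)) (l d) = frechet_derivative (\<lambda>x. c * h (l x)) (at x) d"
      if "x \<in> l -` S" for x
      using fun_cong[OF frechet_derivative_at[OF der]] that by simp
    show "Ck_on n (l -` S) (\<lambda>x. c * frechet_derivative h (at (l x)) (l d))"
      using Suc.prems by (intro Suc.IH) simp
  qed
  then show ?case
    using der by (auto simp: differentiable_def)
qed

section \<open>Partial derivatives in the plane\<close>

lemma partials_from_derivative:
  assumes "(g has_derivative g') (at p)"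
  shows "partial1 g p = g' (1, 0)" and "partial2 g p = g' (0, 1)"
proof -
  obtain a b where p: "p = (a, b)" by force
  interpret bounded_linear g' using assms by (rule has_derivative_bounded_linear)
  have "((\<lambda>s. g (s, b)) has_derivative (\<lambda>h. g' (h, 0))) (at a)"
    using assms unfolding p
    by (intro has_derivative_compose[where g = g and f = "\<lambda>s. (s, b)"]
        has_derivative_Pair has_derivative_ident has_derivative_const)
  moreover have "(\<lambda>h. g' (h, 0)) = (*) (g' (1, 0))"
  proof
    show "g' (h, 0) = g' (1, 0) * h" for h
      using scaleR[of h "(1, 0)"] by (simp add: mult.commute)
  qed
  ultimately show "partial1 g p = g' (1, 0)"
    by (simp add: partial1_def p has_field_derivative_def DERIV_imp_deriv)
  have "((\<lambda>s. g (a, s)) has_derivative (\<lambda>h. g' (0, h))) (at b)"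
    using assms unfolding p
    by (intro has_derivative_compose[where g = g and f = "\<lambda>s. (a, s)"]
        has_derivative_Pair has_derivative_ident has_derivative_const)
  moreover have "(\<lambda>h. g' (0, h)) = (*) (g' (0, 1))"
  proof
    show "g' (0, h) = g' (0, 1) * h" for h
      using scaleR[of h "(0, 1)"] by (simp add: mult.commute)
  qed
  ultimately show "partial2 g p = g' (0, 1)"
    by (simp add: partial2_def p has_field_derivative_def DERIV_imp_deriv)
qed

lemma has_derivative_partials:
  assumes "g differentiable (at p)"
  shows "(g has_derivative (\<lambda>d. partial1 g p * fst d + partial2 g p * snd d)) (at p)"
proof -
  obtain g' where g': "(g has_derivative g') (at p)"
    using assms by (auto simp: differentiable_def)
  interpret bounded_linear g' using g' by (rule has_derivative_bounded_linear)
  have "g' d = partial1 g p * fst d + partial2 g p * snd d" for d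
  proof -
    have "d = fst d *\<^sub>R (1, 0) + snd d *\<^sub>R (0, 1)"
      by (simp add: prod_eq_iff)
    then have "g' d = fst d *\<^sub>R g' (1, 0) + snd d *\<^sub>R g' (0, 1)"
      by (metis add scaleR)
    then show ?thesis
      by (simp add: partials_from_derivative[OF g'] mult.commute)
  qed
  then have "g' = (\<lambda>d. partial1 g p * fst d + partial2 g p * snd d)"
    by (rule ext)
  then show ?thesis
    using g' by simp
qed

lemma smooth_on_differentiable:
  assumes "smooth_on S h" and "x \<in> S"
  shows "h differentiable (at x)"
proof -
  have "Ck_on (Suc 0) S h"
    using assms(1) unfolding smooth_on_def by blast
  then show ?thesis
    using assms(2) by simp
qed

text \<open>
  Near \<open>p\<close> the partial derivative is the Frechet derivative in the direction \<open>(1, 0)\<close>, to which the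
  second level of \<open>Ck_on\<close> applies; openness of \<open>S\<close> lets this differentiability pass to \<open>partial1 h\<close>.
\<close>

lemma smooth_on_differentiable_partial1:
  assumes "open S" and "smooth_on S h" and "p \<in> S"
  shows "partial1 h differentiable (at p)"
proof -
  have "Ck_on (Suc (Suc 0)) S h"
    using assms(2) unfolding smooth_on_def by blast
  then have "(\<lambda>x. frechet_derivative h (at x) (1, 0)) differentiable (at p)"
    using assms(3) by simp
  then obtain D where "((\<lambda>x. frechet_derivative h (at x) (1, 0)) has_derivative D) (at p)"
    by (auto simp: differentiable_def)
  moreover have "frechet_derivative h (at x) (1, 0) = partial1 h x" if "x \<in> S" for x
    using partials_from_derivative(1)[OF frechet_derivative_works[THEN iffD1]]
      smooth_on_differentiable[OF assms(2) that] by simp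
  ultimately have "(partial1 h has_derivative D) (at p)"
    by (rule has_derivative_transform_within_open[OF _ assms(1,3)])
  then show ?thesis
    by (auto simp: differentiable_def)
qed

section \<open>The structure equations as scalar equations\<close>

definition area_form :: "real \<times> real \<Rightarrow> real \<times> real \<Rightarrow> real" where
  "area_form a b = fst a * snd b - snd a * fst b"

lemma area_form_multiples_eq_iff:
  "(\<lambda>a b. c * area_form a b) = (\<lambda>a b. d * area_form a b) \<longleftrightarrow> c = d"
proof
  assume "(\<lambda>a b. c * area_form a b) = (\<lambda>a b. d * area_form a b)"
  then have "c * area_form (1, 0) (0, 1) = d * area_form (1, 0) (0, 1)"
    by (rule fun_cong[OF fun_cong])
  then show "c = d"
    by (simp add: area_form_def)
qed simp

lemma ext_d_coefficient:
  assumes "A differentiable (at p)" and "B differentiable (at p)"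
  shows "ext_d (\<lambda>r (dx, dt). A r * dx + B r * dt) p =
    (\<lambda>a b. (partial1 B p - partial2 A p) * area_form a b)"
proof -
  let ?\<omega> = "\<lambda>r (dx, dt). A r * dx + B r * dt"
  have "frechet_derivative (\<lambda>r. ?\<omega> r c) (at p) =
      (\<lambda>d. (partial1 A p * fst d + partial2 A p * snd d) * fst c +
           (partial1 B p * fst d + partial2 B p * snd d) * snd c)" for c
  proof (rule frechet_derivative_at[symmetric])
    show "((\<lambda>r. ?\<omega> r c) has_derivative
        (\<lambda>d. (partial1 A p * fst d + partial2 A p * snd d) * fst c +
             (partial1 B p * fst d + partial2 B p * snd d) * snd c)) (at p)"
      unfolding case_prod_beta
      by (intro has_derivative_add has_derivative_mult_left has_derivative_partials assms)
  qed
  then show ?thesis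
    unfolding ext_d_def by (intro ext) (simp add: area_form_def algebra_simps)
qed

lemma wedge_coefficient:
  "wedge (\<lambda>r (dx, dt). A r * dx + B r * dt) (\<lambda>r (dx, dt). A' r * dx + B' r * dt) p =
    (\<lambda>a b. (A p * B' p - B p * A' p) * area_form a b)"
  by (intro ext) (simp add: wedge_def area_form_def case_prod_beta algebra_simps)

text \<open>
  A 2-form on the plane is a multiple of the area form at each point, so an equation between
  2-forms is one between their coefficients.
\<close>

lemma structure_equations_iff:
  assumes "A1 differentiable (at p)" and "B1 differentiable (at p)"
    and "A2 differentiable (at p)" and "B2 differentiable (at p)"
    and "A3 differentiable (at p)" and "B3 differentiable (at p)"
  shows "structure_equations \<delta> (\<lambda>r (dx, dt). A1 r * dx + B1 r * dt)
      (\<lambda>r (dx, dt). A2 r * dx + B2 r * dt) (\<lambda>r (dx, dt). A3 r * dx + B3 r * dt) p \<longleftrightarrow>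
    partial1 B1 p - partial2 A1 p = A3 p * B2 p - B3 p * A2 p \<and>
    partial1 B2 p - partial2 A2 p = A1 p * B3 p - B1 p * A3 p \<and>
    partial1 B3 p - partial2 A3 p = \<delta> * (A1 p * B2 p - B1 p * A2 p)"
  unfolding structure_equations_def ext_d_coefficient[OF assms(1,2)]
    ext_d_coefficient[OF assms(3,4)] ext_d_coefficient[OF assms(5,6)] wedge_coefficient
    mult.assoc[symmetric, of \<delta> _ "area_form _ _"] area_form_multiples_eq_iff ..

section \<open>The structure equations as the PDE system\<close>

text \<open>
  The two scalar equations on the right are obtained from the two on the left by eliminating the
  cross terms: the combination with weights \<open>k2, k1\<close> cancels the terms with \<open>\<delta>\<close>, the one with
  weights \<open>qu, qv\<close> cancels the terms with \<open>Q\<close>. Cramer's rule inverts both combinations.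
\<close>

lemma cramer_for_mixed_derivatives:
  fixes X Y :: real
  assumes "k2 * qv - k1 * qu \<noteq> 0"
  shows "X = k0 / (k2 * qv - k1 * qu) * (qv + L * (\<delta> * k1 * W - Q * qv)) \<and>
      Y = - k0 / (k2 * qv - k1 * qu) * (qu + L * (\<delta> * k2 * W - Q * qu)) \<longleftrightarrow>
    k2 * X + k1 * Y = k0 * (1 - Q * L) \<and> qu * X + qv * Y = - \<delta> * k0 * W * L"
  (is "?l \<longleftrightarrow> ?r")
proof -
  define \<Delta> where "\<Delta> = k2 * qv - k1 * qu"
  have "\<Delta> \<noteq> 0" using assms by (simp add: \<Delta>_def)
  then have l: "?l \<longleftrightarrow> \<Delta> * X = k0 * (qv + L * (\<delta> * k1 * W - Q * qv)) \<and>
      \<Delta> * Y = - k0 * (qu + L * (\<delta> * k2 * W - Q * qu))"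
    unfolding \<Delta>_def[symmetric] by (simp add: field_simps)
  show ?thesis
  proof
    assume ?l
    then have X: "\<Delta> * X = k0 * (qv + L * (\<delta> * k1 * W - Q * qv))"
      and Y: "\<Delta> * Y = - k0 * (qu + L * (\<delta> * k2 * W - Q * qu))"
      using l by auto
    have "\<Delta> * (k2 * X + k1 * Y) = k2 * (\<Delta> * X) + k1 * (\<Delta> * Y)"
      by (simp add: algebra_simps)
    also have "\<dots> = \<Delta> * (k0 * (1 - Q * L))"
      unfolding X Y by (simp add: \<Delta>_def algebra_simps)
    finally have 1: "\<Delta> * (k2 * X + k1 * Y) = \<Delta> * (k0 * (1 - Q * L))" .
    have "\<Delta> * (qu * X + qv * Y) = qu * (\<Delta> * X) + qv * (\<Delta> * Y)"
      by (simp add: algebra_simps)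
    also have "\<dots> = \<Delta> * (- \<delta> * k0 * W * L)"
      unfolding X Y by (simp add: \<Delta>_def algebra_simps)
    finally show ?r
      using 1 \<open>\<Delta> \<noteq> 0\<close> by (simp only: mult_cancel_left) simp
  next
    assume ?r
    then have 1: "k2 * X + k1 * Y = k0 * (1 - Q * L)"
      and 2: "qu * X + qv * Y = - \<delta> * k0 * W * L"
      by auto
    have "\<Delta> * X = qv * (k2 * X + k1 * Y) - k1 * (qu * X + qv * Y)"
      and "\<Delta> * Y = k2 * (qu * X + qv * Y) - qu * (k2 * X + k1 * Y)"
      by (simp_all add: \<Delta>_def algebra_simps)
    then show ?l
      unfolding l 1 2 by (simp add: right_diff_distrib distrib_left mult_ac)
  qed
qed

theorem corollary5p6:
  fixes \<delta> k0 k1 k2 k3 \<eta> :: real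
    and U :: "(real \<times> real) set"
    and q :: "real \<times> real \<Rightarrow> real"
    and sys :: "(real \<times> real \<Rightarrow> real) \<Rightarrow> (real \<times> real \<Rightarrow> real) \<Rightarrow> real \<times> real \<Rightarrow> bool"
    and f :: "nat \<Rightarrow> nat \<Rightarrow> jet \<Rightarrow> real"
  assumes "\<delta> = 1 \<or> \<delta> = -1"
    and "k0 \<noteq> 0" and "k1 \<noteq> 0" and "k2 \<noteq> 0" and "\<eta> \<noteq> 0"
    and "open U" and "U \<noteq> {}" and "smooth_on U q"
    and "\<And>z. z \<in> U \<Longrightarrow> k2 * partial2 q z - k1 * partial1 q z \<noteq> 0"
    and "\<And>u v p. sys u v p \<longleftrightarrow>
      (let ux = partial1 u p; vx = partial1 v p;
           Q = q (ux, vx); qu = partial1 q (ux, vx); qv = partial2 q (ux, vx);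
           L = k1 * v p + k2 * u p + k3
       in partial2 (partial1 u) p =
            k0 / (k2 * qv - k1 * qu) * (qv + L * (\<delta> * k1 * (k1 * vx + k2 * ux) - Q * qv)) \<and>
          partial2 (partial1 v) p =
            - k0 / (k2 * qv - k1 * qu) * (qu + L * (\<delta> * k2 * (k1 * vx + k2 * ux) - Q * qu)))"
    and "\<And>u ux v vx. f 1 1 (u, ux, v, vx) = \<eta> * (k1 * vx + k2 * ux)"
    and "\<And>u ux v vx. f 1 2 (u, ux, v, vx) = 0"
    and "\<And>u ux v vx. f 2 1 (u, ux, v, vx) = \<eta>\<^sup>2"
    and "\<And>u ux v vx. f 2 2 (u, ux, v, vx) = k0 * (k1 * v + k2 * u) + k0 * k3"
    and "\<And>u ux v vx. f 3 1 (u, ux, v, vx) = \<eta> * q (ux, vx)"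
    and "\<And>u ux v vx. f 3 2 (u, ux, v, vx) = 1 / \<eta> * k0"
  shows "(\<delta> = 1 \<longrightarrow> describes_pseudospherical_surfaces {(u, ux, v, vx). (ux, vx) \<in> U} sys f)
       \<and> (\<delta> = -1 \<longrightarrow> describes_spherical_surfaces {(u, ux, v, vx). (ux, vx) \<in> U} sys f)"
proof -
  note k0 = assms(2) and k1 = assms(3) and k2 = assms(4) and \<eta> = assms(5)
    and sys = assms(10) and f = assms(11-16)
  define D :: "jet set" where "D = {(u, ux, v, vx). (ux, vx) \<in> U}"
  \<comment> \<open>\<open>D\<close> is a cylinder over \<open>U\<close>, and \<open>f 3 1\<close> factors through its projection \<open>l\<close>.\<close>
  define l :: "jet \<Rightarrow> real \<times> real" where "l = (\<lambda>z. (fst (snd z), snd (snd (snd z))))"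
  have D: "D = l -` U"
    by (auto simp: D_def l_def)
  have l: "bounded_linear l"
    unfolding l_def by (intro bounded_linear_intros)

  have "open D"
    unfolding D using assms(6) l by (simp add: open_vimage linear_continuous_on)
  moreover have "D \<noteq> {}"
    using assms(7) by (auto simp: D_def)
  moreover have "smooth_on D (f i j)" if "i \<in> {1..3}" and "j \<in> {1..2}" for i j
  proof -
    have feq: "f 1 1 = (\<lambda>z. \<eta> * (k1 * snd (snd (snd z)) + k2 * fst (snd z)) + 0)"
      "f 1 2 = (\<lambda>_. 0)" "f 2 1 = (\<lambda>_. \<eta>\<^sup>2)"
      "f 2 2 = (\<lambda>z. k0 * (k1 * fst (snd (snd z)) + k2 * fst z) + k0 * k3)"
      "f 3 1 = (\<lambda>z. \<eta> * q (l z))" "f 3 2 = (\<lambda>_. 1 / \<eta> * k0)"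
      using f by (auto simp: l_def)
    have "smooth_on D (f 1 1)" "smooth_on D (f 2 2)"
      unfolding feq by (intro smooth_on_affine bounded_linear_intros)+
    moreover have "smooth_on D (f 1 2)" "smooth_on D (f 2 1)" "smooth_on D (f 3 2)"
      unfolding feq by (rule smooth_on_const)+
    moreover have "smooth_on D (f 3 1)"
      using assms(6,8) l unfolding feq D smooth_on_def
      by (blast intro: Ck_on_scaled_compose_linear)
    moreover have "i = 1 \<or> i = 2 \<or> i = 3" "j = 1 \<or> j = 2"
      using that by auto
    ultimately show ?thesis
      by blast
  qed
  moreover have "(\<forall>p\<in>\<Omega>. sys u v p) \<longleftrightarrow> (\<forall>p\<in>\<Omega>. structure_equations \<delta>
      (assoc_form f u v 1) (assoc_form f u v 2) (assoc_form f u v 3) p)"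
    if \<Omega>: "open \<Omega>" and u: "smooth_on \<Omega> u" and v: "smooth_on \<Omega> v"
      and jet: "\<forall>p\<in>\<Omega>. jet_of u v p \<in> D" for \<Omega> u v
  proof (rule ball_cong[OF refl])
    fix p assume p: "p \<in> \<Omega>"
    define z where "z = (partial1 u p, partial1 v p)"
    define W where "W = k1 * partial1 v p + k2 * partial1 u p"
    define L where "L = k1 * v p + k2 * u p + k3"
    define X where "X = partial2 (partial1 u) p"
    define Y where "Y = partial2 (partial1 v) p"
    have z: "z \<in> U"
      using jet p by (auto simp: jet_of_def D_def z_def)
    note du = has_derivative_partials[OF smooth_on_differentiable[OF u p]]
      and dv = has_derivative_partials[OF smooth_on_differentiable[OF v p]]
      and dux = has_derivative_partials[OF smooth_on_differentiable_partial1[OF \<Omega> u p]]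
      and dvx = has_derivative_partials[OF smooth_on_differentiable_partial1[OF \<Omega> v p]]
      and dq = has_derivative_partials[OF smooth_on_differentiable[OF assms(8) z]]
    have dA1: "((\<lambda>r. \<eta> * (k1 * partial1 v r + k2 * partial1 u r)) has_derivative
        (\<lambda>d. \<eta> * (k1 * (partial1 (partial1 v) p * fst d + Y * snd d) +
                   k2 * (partial1 (partial1 u) p * fst d + X * snd d)))) (at p)"
      unfolding X_def Y_def by (intro has_derivative_mult_right has_derivative_add dux dvx)
    have dB2: "((\<lambda>r. k0 * (k1 * v r + k2 * u r) + k0 * k3) has_derivative
        (\<lambda>d. k0 * (k1 * (partial1 v p * fst d + partial2 v p * snd d) +
                   k2 * (partial1 u p * fst d + partial2 u p * snd d)) + 0)) (at p)"
      by (intro has_derivative_mult_right has_derivative_add has_derivative_const du dv)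
    have dA3: "((\<lambda>r. \<eta> * q (partial1 u r, partial1 v r)) has_derivative
        (\<lambda>d. \<eta> * (partial1 q z * (partial1 (partial1 u) p * fst d + X * snd d) +
                   partial2 q z * (partial1 (partial1 v) p * fst d + Y * snd d)))) (at p)"
      using has_derivative_mult_right[OF has_derivative_compose[OF
          has_derivative_Pair[OF dux dvx] dq[unfolded z_def]], of \<eta>]
      by (simp add: X_def Y_def z_def)
    note dc = has_derivative_const[of _ "at p"]
    have B2: "k0 * (k1 * v p + k2 * u p) + k0 * k3 = k0 * L"
      by (simp add: L_def algebra_simps)
    have A1_t: "partial2 (\<lambda>r. \<eta> * (k1 * partial1 v r + k2 * partial1 u r)) p = \<eta> * (k1 * Y + k2 * X)"
      using partials_from_derivative(2)[OF dA1] by simp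
    have B2_x: "partial1 (\<lambda>r. k0 * (k1 * v r + k2 * u r) + k0 * k3) p = k0 * W"
      using partials_from_derivative(1)[OF dB2] by (simp add: W_def)
    have A3_t: "partial2 (\<lambda>r. \<eta> * q (partial1 u r, partial1 v r)) p =
        \<eta> * (partial1 q z * X + partial2 q z * Y)"
      using partials_from_derivative(2)[OF dA3] by simp
    have "structure_equations \<delta> (assoc_form f u v 1) (assoc_form f u v 2) (assoc_form f u v 3) p \<longleftrightarrow>
        0 - \<eta> * (k1 * Y + k2 * X) = \<eta> * q z * (k0 * L) - 1 / \<eta> * k0 * \<eta>\<^sup>2 \<and>
        k0 * W - 0 = \<eta> * W * (1 / \<eta> * k0) - 0 * (\<eta> * q z) \<and>
        0 - \<eta> * (partial1 q z * X + partial2 q z * Y) = \<delta> * (\<eta> * W * (k0 * L) - 0 * \<eta>\<^sup>2)"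
      unfolding assoc_form_def jet_of_def f
      by (subst structure_equations_iff[OF differentiableI[OF dA1] differentiableI[OF dc]
              differentiableI[OF dc] differentiableI[OF dB2]
              differentiableI[OF dA3] differentiableI[OF dc]])
         (simp only: A1_t B2_x A3_t partials_from_derivative[OF dc] B2
              W_def[symmetric] z_def[symmetric])
    \<comment> \<open>The second equation has become an identity; the other two carry a common factor \<open>\<eta>\<close>.\<close>
    also have "\<dots> \<longleftrightarrow> \<eta> * (k2 * X + k1 * Y) = \<eta> * (k0 * (1 - q z * L)) \<and>
        \<eta> * (partial1 q z * X + partial2 q z * Y) = \<eta> * (- \<delta> * k0 * W * L)"
      using \<eta> by (auto simp: power2_eq_square algebra_simps)
    also have "\<dots> \<longleftrightarrow> k2 * X + k1 * Y = k0 * (1 - q z * L) \<and>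
        partial1 q z * X + partial2 q z * Y = - \<delta> * k0 * W * L"
      using \<eta> by (simp only: mult_cancel_left) simp
    also have "\<dots> \<longleftrightarrow> sys u v p"
      unfolding sys Let_def cramer_for_mixed_derivatives[OF assms(9)[OF z], symmetric]
      by (simp add: X_def Y_def W_def L_def z_def)
    finally show "sys u v p \<longleftrightarrow> structure_equations \<delta>
        (assoc_form f u v 1) (assoc_form f u v 2) (assoc_form f u v 3) p" ..
  qed
  moreover have "negligible {z \<in> D. f 1 1 z * f 2 2 z - f 1 2 z * f 2 1 z = 0}"
  proof (rule negligible_subset)
    show "negligible ({z :: jet. (0, k2, 0, k1) \<bullet> z = 0} \<union> {z. (k2, 0, k1, 0) \<bullet> z = - k3})"
      using k1 k2 by (intro negligible_Un negligible_hyperplane) (auto simp: zero_prod_def)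
    show "{z \<in> D. f 1 1 z * f 2 2 z - f 1 2 z * f 2 1 z = 0} \<subseteq>
        {z. (0, k2, 0, k1) \<bullet> z = 0} \<union> {z. (k2, 0, k1, 0) \<bullet> z = - k3}"
    proof
      fix z assume z: "z \<in> {z \<in> D. f 1 1 z * f 2 2 z - f 1 2 z * f 2 1 z = 0}"
      obtain u ux v vx where z_eq: "z = (u, ux, v, vx)"
        by (cases z)
      have "\<eta> * (k1 * vx + k2 * ux) * (k0 * (k1 * v + k2 * u) + k0 * k3) - 0 * \<eta>\<^sup>2 = 0"
        using z unfolding z_eq mem_Collect_eq f by (rule conjunct2)
      then have "\<eta> * k0 * ((k2 * ux + k1 * vx) * (k2 * u + k1 * v + k3)) = 0"
        by (simp add: algebra_simps)
      then have "k2 * ux + k1 * vx = 0 \<or> k2 * u + k1 * v = - k3"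
        using \<eta> k0 by (auto simp: eq_neg_iff_add_eq_0)
      then show "z \<in> {z. (0, k2, 0, k1) \<bullet> z = 0} \<union> {z. (k2, 0, k1, 0) \<bullet> z = - k3}"
        by (simp add: z_eq)
    qed
  qed
  ultimately have "describes_surfaces \<delta> D sys f"
    unfolding describes_surfaces_def by blast
  then show ?thesis
    by (auto simp: D_def describes_pseudospherical_surfaces_def describes_spherical_surfaces_def)
qed

end
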